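(* Let $-\infty<a<b<\infty$. I. Let $0\le\beta<\alpha<1$ be arbitrary and let $f\in C[a,b]$ be continuously Riemann-Liouville $\alpha$-differentiable. Then: (i) $f$ is continuously Riemann-Liouville $\beta$-differentiable, with ${}^{RL}D_a^{\beta}f\in C[a,b]$. Moreover, $({}^{RL}D_a^{\beta}f)(a)=0$. (ii) The continuous fractional derivative $f_1:={}^{RL}D_a^{\beta}f\in C[a,b]$ is continuously Riemann-Liouville $(\alpha-\beta)$-differentiable. Moreover, ${}^{RL}D_a^{\alpha-\beta}f_1={}^{RL}D_a^{\alpha}f$; thus ${}^{RL}D_a^{\alpha-\beta}({}^{RL}D_a^{\beta}f)={}^{RL}D_a^{\alpha}f$. (iii) If $f\in C^1[a,b]$ and $f(a)=0$, then for any $0\le\beta\le 1$ the function $f$ is continuously Riemann-Liouville $\beta$-differentiable with derivative $f_1={}^{RL}D_a^{\beta}f\in C[a,b]$. Moreover, ${}^{RL}D_a^{1-\beta}f_1=Df$; thus ${}^{RL}D_a^{1-\beta}({}^{RL}D_a^{\beta}f)=Df$. II. Conversely, let $0<\beta<1$ and $\gamma>0$ be arbitrary. Assume that a function $h\in C[a,b]$ is continuously Riemann-Liouville $\beta$-differentiable with derivative $h_1:={}^{RL}D_a^{\beta}h$, and that $h_1$ is continuously Riemann-Liouville $\gamma$-differentiable. Then $h$ is continuously Riemann-Liouville $(\beta+\gamma)$-differentiable, and ${}^{RL}D_a^{\gamma}h_1={}^{RL}D_a^{\beta+\gamma}h$; thus ${}^{RL}D_a^{\gamma}({}^{RL}D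_a^{\beta}h)={}^{RL}D_a^{\beta+\gamma}h$.
   Context: Let $[a,b]\subset\mathbb{R}$, $-\infty<a<b<\infty$. For $\alpha>0$ the Riemann-Liouville fractional integral operator is $J_a^\alpha f(x):=\frac{1}{\Gamma(\alpha)}\int_a^x (x-t)^{\alpha-1}f(t)\,dt$ for $a\le x\le b$; $J_a^0$ is the identity. $D^m$ denotes the ordinary derivative of integer order $m$, $D=D^1$. For $\alpha>0$ and $m:=\lceil\alpha\rceil$, the Riemann-Liouville fractional derivative of order $\alpha$ is ${}^{RL}D_a^{\alpha}f:=D^mJ_a^{m-\alpha}f$; ${}^{RL}D_a^0$ is the identity. A function $f$ is called continuously Riemann-Liouville $\alpha$-differentiable if $f\in C[a,b]$ and $D^mJ_a^{m-\alpha}f$ exists and belongs to $C[a,b]$ (for $\alpha=0$: if $f\in C[a,b]$). *)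

theory Defs
  imports "HOL-Analysis.Analysis"
begin

text \<open>
  Functions on [a,b] are represented by total functions on the reals. The values on [a,b] of
  everything below depend only on the values of the argument on [a,b]. Derivatives are taken within [a,b], hence are one-sided at a and b.
\<close>

definition rl_integral :: "real \<Rightarrow> real \<Rightarrow> (real \<Rightarrow> real) \<Rightarrow> real \<Rightarrow> real" where
  "rl_integral a \<alpha> f x =
     (if \<alpha> = 0 then f x
      else 1 / Gamma \<alpha> * (LBINT t:{a..x}. (x - t) powr (\<alpha> - 1) * f t))"

definition deriv_on :: "real \<Rightarrow> real \<Rightarrow> (real \<Rightarrow> real) \<Rightarrow> real \<Rightarrow> real" where
  "deriv_on a b f x = vector_derivative f (at x within {a..b})"

definition times_differentiable_on :: "nat \<Rightarrow> real \<Rightarrow> real \<Rightarrow> (real \<Rightarrow> real) \<Rightarrow> bool" where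
  "times_differentiable_on m a b f \<longleftrightarrow>
     (\<forall>k<m. ((deriv_on a b ^^ k) f) differentiable_on {a..b})"

definition C1_on :: "real \<Rightarrow> real \<Rightarrow> (real \<Rightarrow> real) \<Rightarrow> bool" where
  "C1_on a b f \<longleftrightarrow> f differentiable_on {a..b} \<and> continuous_on {a..b} (deriv_on a b f)"

text \<open>For order 0 the following is the identity, see the lemmas at the end.\<close>

definition rl_deriv :: "real \<Rightarrow> real \<Rightarrow> real \<Rightarrow> (real \<Rightarrow> real) \<Rightarrow> real \<Rightarrow> real" where
  "rl_deriv a b \<alpha> f =
     (deriv_on a b ^^ nat \<lceil>\<alpha>\<rceil>) (rl_integral a (of_int \<lceil>\<alpha>\<rceil> - \<alpha>) f)"

text \<open>
  \<^const>\<open>vector_derivative\<close> is a total function, so existence of the derivative is required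
  separately from its continuity.
\<close>

definition cont_rl_differentiable :: "real \<Rightarrow> real \<Rightarrow> real \<Rightarrow> (real \<Rightarrow> real) \<Rightarrow> bool" where
  "cont_rl_differentiable a b \<alpha> f \<longleftrightarrow>
     continuous_on {a..b} f \<and>
     times_differentiable_on (nat \<lceil>\<alpha>\<rceil>) a b (rl_integral a (of_int \<lceil>\<alpha>\<rceil> - \<alpha>) f) \<and>
     continuous_on {a..b} (rl_deriv a b \<alpha> f)"

lemma rl_deriv_0 [simp]: "rl_deriv a b 0 f = f"
  by (simp add: rl_deriv_def rl_integral_def fun_eq_iff)

lemma cont_rl_differentiable_0 [simp]:
  "cont_rl_differentiable a b 0 f \<longleftrightarrow> continuous_on {a..b} f"
  by (simp add: cont_rl_differentiable_def times_differentiable_on_def)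

end

theory Submission
  imports Defs
begin

text \<open>
  Write \<open>J\<^sup>\<alpha>\<close> for the fractional integral from \<open>a\<close>. Fubini and the Beta integral give the semigroup law
  \<open>J\<^sup>\<alpha> J\<^sup>\<beta> = J\<^sup>\<alpha>\<^sup>+\<^sup>\<beta>\<close> on continuous functions. If \<open>0 < \<alpha> < 1\<close> and \<open>f\<close> has the continuous derivative \<open>g\<close> of
  order \<open>\<alpha>\<close>, then \<open>J\<^sup>1\<^sup>-\<^sup>\<alpha> f = J\<^sup>1 g\<close>, since the left-hand side vanishes at \<open>a\<close>. Applying \<open>J\<^sup>\<alpha>\<close> to both sides
  yields \<open>J\<^sup>1 f = J\<^sup>1 (J\<^sup>\<alpha> g)\<close>, and hence \<open>f = J\<^sup>\<alpha> g\<close> by differentiation. With this representation every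
  claim reduces to the semigroup law; for instance \<open>J\<^sup>1\<^sup>-\<^sup>\<beta> f = J\<^sup>1 (J\<^sup>\<alpha>\<^sup>-\<^sup>\<beta> g)\<close>, so that
  \<open>J\<^sup>\<alpha>\<^sup>-\<^sup>\<beta> g\<close> is the derivative of \<open>f\<close> of order \<open>\<beta>\<close>.
\<close>

section \<open>Integrability on intervals, reflection, and the Beta kernel\<close>

text \<open>Bridge from gauge to Lebesgue integrals: nonnegativity makes integrability absolute, and
  Borel measurability allows the passage from the completed measure to \<open>lborel\<close>. It
  serves to import the known integrals of powers and of the Beta function.\<close>

lemma set_integrable_lborel_nonneg:
  fixes f :: "real \<Rightarrow> real"
  assumes "f integrable_on A" "\<And>x. x \<in> A \<Longrightarrow> 0 \<le> f x"
    and [measurable]: "A \<in> sets borel" "f \<in> borel_measurable borel"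
  shows "set_integrable lborel A f"
proof -
  have "f absolutely_integrable_on A"
    by (rule nonnegative_absolutely_integrable_1) (use assms in auto)
  then show ?thesis
    unfolding set_integrable_def by (subst (asm) integrable_completion) auto
qed

lemma indicator_Icc_reflect:
  fixes s x v :: real
  assumes "s < x"
  shows "indicat_real {s..x} (x + - (x - s) * v) = indicat_real {0..1} v"
proof -
  have "s \<le> x + - (x - s) * v \<longleftrightarrow> (x - s) * v \<le> (x - s) * 1" by (simp add: algebra_simps)
  also have "\<dots> \<longleftrightarrow> v \<le> 1" using assms by (subst mult_le_cancel_left_pos) auto
  finally have "s \<le> x + - (x - s) * v \<longleftrightarrow> v \<le> 1" .
  moreover have "x + - (x - s) * v \<le> x \<longleftrightarrow> 0 \<le> v"
    using assms zero_le_mult_iff[of "x - s" v] by (simp only: mult_minus_left) auto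
  ultimately show ?thesis
    by (auto simp: indicator_def)
qed

text \<open>The substitution \<open>t = x - (x - s) * v\<close> moves the singular endpoint
  \<open>x\<close> to \<open>v = 0\<close> and replaces \<open>{s..x}\<close> by the fixed interval
  \<open>{0..1}\<close>.\<close>

lemma
  fixes F :: "real \<Rightarrow> real"
  assumes "s < x"
  shows set_integral_reflect:
      "(LBINT t:{s..x}. F t) = (x - s) * (LBINT v:{0..1}. F (x - (x - s) * v))"
    and set_integrable_reflect:
      "set_integrable lborel {s..x} F \<longleftrightarrow> set_integrable lborel {0..1} (\<lambda>v. F (x - (x - s) * v))"
proof -
  have *: "indicat_real {s..x} (x + - (x - s) * v) *\<^sub>R F (x + - (x - s) * v) =
      indicat_real {0..1} v *\<^sub>R F (x - (x - s) * v)" for v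
    using indicator_Icc_reflect[OF assms, of v] by (simp only: mult_minus_left add_uminus_conv_diff)
  show "(LBINT t:{s..x}. F t) = (x - s) * (LBINT v:{0..1}. F (x - (x - s) * v))"
    unfolding set_lebesgue_integral_def
    using assms lborel_integral_real_affine[of "- (x - s)" "\<lambda>t. indicat_real {s..x} t *\<^sub>R F t" x]
    by (simp only: *) simp
  show "set_integrable lborel {s..x} F \<longleftrightarrow> set_integrable lborel {0..1} (\<lambda>v. F (x - (x - s) * v))"
    unfolding set_integrable_def
    using assms lborel_integrable_real_affine_iff[of "- (x - s)" "\<lambda>t. indicat_real {s..x} t *\<^sub>R F t" x]
    by (simp only: *)
qed

lemma set_integrable_powr_01:
  fixes \<alpha> :: real
  assumes "\<alpha> > 0"
  shows "set_integrable lborel {0..1} (\<lambda>v. v powr (\<alpha> - 1))"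
  by (rule set_integrable_lborel_nonneg)
    (use assms has_integral_powr_from_0[of "\<alpha> - 1" 1] in auto)

text \<open>After reflection the factors are \<open>(x - s) * v\<close> and
  \<open>(x - s) * (1 - v)\<close>. Their powers release the exponent
  \<open>\<alpha> + \<beta> - 2\<close> of \<open>x - s\<close>, the Jacobian adds one more, and
  Euler's Beta integral remains.\<close>

lemma
  fixes \<alpha> \<beta> s x :: real
  assumes "\<alpha> > 0" "\<beta> > 0" "s < x"
  shows set_integrable_Beta_kernel:
      "set_integrable lborel {s..x} (\<lambda>t. (x - t) powr (\<alpha> - 1) * (t - s) powr (\<beta> - 1))"
    and set_integral_Beta_kernel:
      "(LBINT t:{s..x}. (x - t) powr (\<alpha> - 1) * (t - s) powr (\<beta> - 1)) =
         (x - s) powr (\<alpha> + \<beta> - 1) * Beta \<alpha> \<beta>"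
proof -
  let ?B = "\<lambda>v::real. v powr (\<alpha> - 1) * (1 - v) powr (\<beta> - 1)"
  have B: "set_integrable lborel {0..1} ?B"
    by (rule set_integrable_lborel_nonneg)
      (use has_integral_Beta_real[OF assms(1,2)] in \<open>auto simp: integrable_on_def\<close>)
  have iB: "(LBINT v:{0..1}. ?B v) = Beta \<alpha> \<beta>"
    using has_integral_Beta_real[OF assms(1,2)] set_borel_integral_eq_integral(2)[OF B]
    by (simp add: integral_unique)
  have eq: "(x - (x - (x - s) * v)) powr (\<alpha> - 1) * ((x - (x - s) * v) - s) powr (\<beta> - 1)
      = (x - s) powr (\<alpha> + \<beta> - 2) * ?B v" if "v \<in> {0..1}" for v
  proof -
    have "(x - (x - s) * v) - s = (x - s) * (1 - v)" by (simp add: algebra_simps)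
    moreover have "((x - s) * v) powr (\<alpha> - 1) = (x - s) powr (\<alpha> - 1) * v powr (\<alpha> - 1)"
      by (rule powr_mult)
    moreover have "((x - s) * (1 - v)) powr (\<beta> - 1) = (x - s) powr (\<beta> - 1) * (1 - v) powr (\<beta> - 1)"
      by (rule powr_mult)
    moreover have "(x - s) powr (\<alpha> + \<beta> - 2) = (x - s) powr (\<alpha> - 1) * (x - s) powr (\<beta> - 1)"
      by (simp flip: powr_add)
    ultimately show ?thesis by simp
  qed
  have "set_integrable lborel {0..1} (\<lambda>v. (x - s) powr (\<alpha> + \<beta> - 2) * ?B v)"
    using B by (intro set_integrable_mult_right)
  then show "set_integrable lborel {s..x} (\<lambda>t. (x - t) powr (\<alpha> - 1) * (t - s) powr (\<beta> - 1))"
    unfolding set_integrable_reflect[OF assms(3)]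
    by (subst set_integrable_cong[OF refl refl eq])
  have "(LBINT t:{s..x}. (x - t) powr (\<alpha> - 1) * (t - s) powr (\<beta> - 1)) =
      (x - s) * (LBINT v:{0..1}. (x - s) powr (\<alpha> + \<beta> - 2) * ?B v)"
    unfolding set_integral_reflect[OF assms(3)]
    by (intro arg_cong2[where f = "(*)"] set_lebesgue_integral_cong refl allI impI eq) auto
  also have "\<dots> = (x - s) * (x - s) powr (\<alpha> + \<beta> - 2) * Beta \<alpha> \<beta>"
    by (simp add: iB)
  also have "(x - s) * (x - s) powr (\<alpha> + \<beta> - 2) = (x - s) powr (\<alpha> + \<beta> - 1)"
    using assms powr_mult_base[of "x - s" "\<alpha> + \<beta> - 2"] by (simp add: algebra_simps)
  finally show "(LBINT t:{s..x}. (x - t) powr (\<alpha> - 1) * (t - s) powr (\<beta> - 1)) =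
         (x - s) powr (\<alpha> + \<beta> - 1) * Beta \<alpha> \<beta>" .
qed

section \<open>The fractional integral and its semigroup law for bounded functions\<close>

lemma rl_integral_cong:
  assumes "\<And>t. t \<in> {a..x} \<Longrightarrow> f t = g t" "a \<le> x"
  shows "rl_integral a \<alpha> f x = rl_integral a \<alpha> g x"
proof -
  have "(LBINT t:{a..x}. (x - t) powr (\<alpha> - 1) * f t) = (LBINT t:{a..x}. (x - t) powr (\<alpha> - 1) * g t)"
    by (rule set_lebesgue_integral_cong) (use assms in auto)
  with assms show ?thesis by (simp add: rl_integral_def)
qed

lemma rl_integral_left_endpoint: "\<alpha> \<noteq> 0 \<Longrightarrow> rl_integral a \<alpha> f a = 0"
proof -
  assume "\<alpha> \<noteq> 0"
  \<comment> \<open>The integrand is itself zero at its only point, since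
    \<open>0 powr (\<alpha> - 1) = 0\<close>.\<close>
  have "(LBINT t:{a..a}. (a - t) powr (\<alpha> - 1) * f t) = (LBINT t:{a..a}. 0)"
    by (rule set_lebesgue_integral_cong) auto
  with \<open>\<alpha> \<noteq> 0\<close> show ?thesis by (simp add: rl_integral_def)
qed

lemma set_integrable_kernel:
  fixes \<alpha> a x :: real
  assumes "\<alpha> > 0"
  shows "set_integrable lborel {a..x} (\<lambda>t. (x - t) powr (\<alpha> - 1))"
proof (cases "a < x")
  case True
  have "set_integrable lborel {0..1} (\<lambda>v. (x - a) powr (\<alpha> - 1) * v powr (\<alpha> - 1))"
    using set_integrable_powr_01[OF assms] by (intro set_integrable_mult_right)
  moreover have "(x - (x - (x - a) * v)) powr (\<alpha> - 1) = (x - a) powr (\<alpha> - 1) * v powr (\<alpha> - 1)"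
    if "v \<in> {0..1}" for v
    using True that by (simp add: powr_mult)
  ultimately show ?thesis
    unfolding set_integrable_reflect[OF True] by (subst set_integrable_cong[OF refl refl]) auto
next
  case False
  \<comment> \<open>The interval is empty or consists of \<open>x\<close> alone, where the kernel is
    \<open>0 powr (\<alpha> - 1) = 0\<close>.\<close>
  then have "(\<lambda>t. indicat_real {a..x} t *\<^sub>R (x - t) powr (\<alpha> - 1)) = (\<lambda>_. 0)"
    by (auto simp: indicator_def fun_eq_iff)
  then show ?thesis by (simp add: set_integrable_def)
qed

text \<open>Both sides integrate one kernel over the triangle
  \<open>a \<le> s \<le> t \<le> x\<close>. Integrating over \<open>t\<close> first produces the
  Beta kernel, and the Gamma factors in \<open>Beta \<alpha> \<beta>\<close> match the
  normalizations. The bound on \<open>f\<close> supplies the absolute integrability that Fubini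
  requires.\<close>

lemma rl_integral_semigroup_bounded:
  fixes a x \<alpha> \<beta> :: real
  assumes "\<alpha> > 0" "\<beta> > 0" "a \<le> x" and [measurable]: "f \<in> borel_measurable borel"
    and M: "\<And>t. \<bar>f t\<bar> \<le> M"
  shows "rl_integral a \<alpha> (rl_integral a \<beta> f) x = rl_integral a (\<alpha> + \<beta>) f x"
proof -
  \<comment> \<open>Extension by zero outside the triangle lets both iterated integrals run over the
    whole line; \<open>Ks\<close> and \<open>Kt\<close> are the factorizations suited to the two
    orders of integration.\<close>
  define K where "K s t =
    (if a \<le> s \<and> s \<le> t \<and> t \<le> x then (x - t) powr (\<alpha> - 1) * (t - s) powr (\<beta> - 1) * f s else 0)"
    for s t
  have Ks: "K s = (\<lambda>t. (indicator {a..x} s * f s) *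
      (indicator {s..x} t *\<^sub>R ((x - t) powr (\<alpha> - 1) * (t - s) powr (\<beta> - 1))))" for s
    by (auto simp: K_def fun_eq_iff)
  have kern: "integrable lborel (\<lambda>t. indicator {s..x} t *\<^sub>R ((x - t) powr (\<alpha> - 1) * (t - s) powr (\<beta> - 1)))
    \<and> (\<integral>t. indicator {s..x} t *\<^sub>R ((x - t) powr (\<alpha> - 1) * (t - s) powr (\<beta> - 1)) \<partial>lborel)
      = (x - s) powr (\<alpha> + \<beta> - 1) * Beta \<alpha> \<beta>" if "s \<le> x" for s
  proof (cases "s < x")
    case True
    then show ?thesis
      using set_integrable_Beta_kernel[OF assms(1,2) True] set_integral_Beta_kernel[OF assms(1,2) True]
      by (simp add: set_integrable_def set_lebesgue_integral_def)
  next
    \<comment> \<open>In the degenerate case \<open>s = x\<close> both sides vanish, again because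
      powers with base 0 are 0.\<close>
    case False
    with that have "s = x" by simp
    have "(\<lambda>t. indicator {s..x} t *\<^sub>R ((x - t) powr (\<alpha> - 1) * (t - s) powr (\<beta> - 1))) = (\<lambda>_. 0)"
      by (auto simp: \<open>s = x\<close> fun_eq_iff indicator_def)
    then show ?thesis by (simp add: \<open>s = x\<close>)
  qed
  have int_t: "integrable lborel (K s)" for s
    unfolding Ks using kern[of s] by (cases "s \<le> x") (auto simp: indicator_def)
  have inner_t: "(\<integral>t. K s t \<partial>lborel) =
      Beta \<alpha> \<beta> * (indicator {a..x} s *\<^sub>R ((x - s) powr (\<alpha> + \<beta> - 1) * f s))" for s
    unfolding Ks using kern[of s] by (cases "s \<le> x") (auto simp: indicator_def)
  \<comment> \<open>The kernel factors are nonnegative, so the sign of \<open>K s t\<close> depends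
    on \<open>s\<close> alone and the integral of the norm over \<open>t\<close> follows from
    \<open>inner_t\<close>.\<close>
  have norm_K: "norm (K s t) = sgn (f s) * K s t" for s t
    by (auto simp: K_def abs_mult abs_sgn_eq sgn_if)
  have norm_t: "(\<integral>t. norm (K s t) \<partial>lborel) =
      Beta \<alpha> \<beta> * (indicator {a..x} s *\<^sub>R ((x - s) powr (\<alpha> + \<beta> - 1) * \<bar>f s\<bar>))" for s
    unfolding norm_K using int_t by (simp add: inner_t) (simp add: abs_sgn)
  have "integrable lborel (\<lambda>s. indicat_real {a..x} s *\<^sub>R ((x - s) powr (\<alpha> + \<beta> - 1) * \<bar>f s\<bar>))"
  proof (rule Bochner_Integration.integrable_bound)
    show "integrable lborel (\<lambda>s. M * (indicat_real {a..x} s *\<^sub>R (x - s) powr (\<alpha> + \<beta> - 1)))"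
      using set_integrable_kernel[of "\<alpha> + \<beta>" a x] assms by (simp add: set_integrable_def)
    have "\<bar>f s\<bar> \<le> \<bar>M\<bar>" for s using M[of s] by linarith
    then show "AE s in lborel. norm (indicat_real {a..x} s *\<^sub>R ((x - s) powr (\<alpha> + \<beta> - 1) * \<bar>f s\<bar>))
        \<le> norm (M * (indicat_real {a..x} s *\<^sub>R (x - s) powr (\<alpha> + \<beta> - 1)))"
      by (intro AE_I2) (auto simp: abs_mult indicator_def mult.commute intro!: mult_right_mono)
  qed measurable
  then have "integrable lborel (\<lambda>s. \<integral>t. norm (K s t) \<partial>lborel)"
    unfolding norm_t by (rule integrable_mult_right)
  then have "integrable (lborel \<Otimes>\<^sub>M lborel) (\<lambda>(s, t). K s t)"
  proof (intro lborel_pair.Fubini_integrable)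
    show "(\<lambda>(s, t). K s t) \<in> borel_measurable (lborel \<Otimes>\<^sub>M lborel)"
      unfolding K_def by measurable
  qed (auto simp: int_t)
  then have fubini: "(\<integral>t. (\<integral>s. K s t \<partial>lborel) \<partial>lborel) = (\<integral>s. (\<integral>t. K s t \<partial>lborel) \<partial>lborel)"
    by (rule lborel_pair.Fubini_integral)
  have Kt: "K s t = indicator {a..x} t * (x - t) powr (\<alpha> - 1) *
      (indicator {a..t} s *\<^sub>R ((t - s) powr (\<beta> - 1) * f s))" for s t
    by (auto simp: K_def)
  \<comment> \<open>The factor \<open>Gamma \<beta>\<close> undoes the normalization inside
    \<open>rl_integral a \<beta> f\<close>.\<close>
  have inner_s: "(\<integral>s. K s t \<partial>lborel) = Gamma \<beta> * (indicator {a..x} t *\<^sub>R ((x - t) powr (\<alpha> - 1) *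
      rl_integral a \<beta> f t))" for t
    using Gamma_real_pos[OF assms(2), THEN less_imp_neq] assms(2)
    unfolding Kt by (simp add: rl_integral_def set_lebesgue_integral_def)
  have "Gamma \<beta> * (LBINT t:{a..x}. (x - t) powr (\<alpha> - 1) * rl_integral a \<beta> f t) =
      Beta \<alpha> \<beta> * (LBINT s:{a..x}. (x - s) powr (\<alpha> + \<beta> - 1) * f s)"
    using fubini unfolding inner_s inner_t set_lebesgue_integral_def by simp
  also have "\<dots> = Gamma \<beta> *
      (Gamma \<alpha> / Gamma (\<alpha> + \<beta>) * (LBINT s:{a..x}. (x - s) powr (\<alpha> + \<beta> - 1) * f s))"
    by (simp add: Beta_def)
  finally have "(LBINT t:{a..x}. (x - t) powr (\<alpha> - 1) * rl_integral a \<beta> f t) =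
      Gamma \<alpha> / Gamma (\<alpha> + \<beta>) * (LBINT s:{a..x}. (x - s) powr (\<alpha> + \<beta> - 1) * f s)"
    using Gamma_real_pos[OF assms(2), THEN less_imp_neq] by (subst (asm) mult_left_cancel) auto
  then show ?thesis
    using assms(1,2) Gamma_real_pos[OF assms(1), THEN less_imp_neq]
    by (simp add: rl_integral_def[of _ \<alpha>] rl_integral_def[of _ "\<alpha> + \<beta>"])
qed

section \<open>Continuity of the fractional integral and the semigroup law on
  \<open>[a,b]\<close>\<close>

text \<open>On the fixed interval \<open>{0..1}\<close> the variable \<open>x\<close> enters only
  through the prefactor and the argument of \<open>f\<close>, no longer through the singular weight.
  This is the form suited to dominated convergence.\<close>

lemma rl_integral_eq_scaled:
  assumes "\<alpha> > 0" "a \<le> x"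
  shows "rl_integral a \<alpha> f x =
    (x - a) powr \<alpha> / Gamma \<alpha> * (LBINT v:{0..1}. v powr (\<alpha> - 1) * f (x - (x - a) * v))"
proof (cases "a = x")
  case True
  then show ?thesis using assms by (simp add: rl_integral_left_endpoint)
next
  case False
  with assms have "a < x" by simp
  have eq: "(x - (x - (x - a) * v)) powr (\<alpha> - 1) * f (x - (x - a) * v) =
      (x - a) powr (\<alpha> - 1) * (v powr (\<alpha> - 1) * f (x - (x - a) * v))" if "v \<in> {0..1}" for v
    using that \<open>a < x\<close> by (simp add: powr_mult)
  have "(LBINT t:{a..x}. (x - t) powr (\<alpha> - 1) * f t) =
    (x - a) * (LBINT v:{0..1}. (x - a) powr (\<alpha> - 1) * (v powr (\<alpha> - 1) * f (x - (x - a) * v)))"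
    unfolding set_integral_reflect[OF \<open>a < x\<close>]
    by (intro arg_cong2[where f = "(*)"] set_lebesgue_integral_cong refl allI impI eq) auto
  also have "\<dots> = (x - a) powr \<alpha> * (LBINT v:{0..1}. v powr (\<alpha> - 1) * f (x - (x - a) * v))"
    using powr_mult_base[of "x - a" "\<alpha> - 1"] \<open>a < x\<close> by simp
  finally show ?thesis
    using assms by (simp add: rl_integral_def)
qed

text \<open>Composing \<open>f\<close> with the projection of the line onto \<open>[a,b]\<close>
  gives the global measurability and boundedness used for Fubini and dominated convergence.\<close>

lemma clamped_extension:
  fixes f :: "real \<Rightarrow> real"
  assumes "a \<le> b" "continuous_on {a..b} f"
  obtains g M where "continuous_on UNIV g" "\<And>t. \<bar>g t\<bar> \<le> M" "\<And>t. t \<in> {a..b} \<Longrightarrow> g t = f t"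
proof -
  define g where "g = (\<lambda>t. f (max a (min b t)))"
  have *: "max a (min b t) \<in> {a..b}" for t using assms(1) by auto
  have "continuous_on UNIV g"
    unfolding g_def
    by (rule continuous_on_compose2[OF assms(2)]) (use * in \<open>auto intro!: continuous_intros\<close>)
  moreover have "bounded (f ` {a..b})"
    using assms(2) by (intro compact_imp_bounded compact_continuous_image) auto
  then obtain M where "\<forall>t\<in>{a..b}. \<bar>f t\<bar> \<le> M"
    unfolding bounded_iff by auto
  then have "\<bar>g t\<bar> \<le> M" for t
    unfolding g_def using * by blast
  moreover have "g t = f t" if "t \<in> {a..b}" for t
    using that by (simp add: g_def)
  ultimately show thesis using that by blast
qed

lemma continuous_on_rl_integral:
  assumes "0 \<le> \<alpha>" "continuous_on {a..b} f"
  shows "continuous_on {a..b} (rl_integral a \<alpha> f)"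
proof (cases "\<alpha> = 0 \<or> b < a")
  case True
  then show ?thesis using assms by (auto simp: rl_integral_def[abs_def])
next
  case False
  with assms have "\<alpha> > 0" "a \<le> b" by auto
  obtain g M where g: "continuous_on UNIV g" "\<And>t. \<bar>g t\<bar> \<le> M" "\<And>t. t \<in> {a..b} \<Longrightarrow> g t = f t"
    using clamped_extension[OF \<open>a \<le> b\<close> assms(2)] by blast
  have [measurable]: "g \<in> borel_measurable borel"
    using g(1) by (rule borel_measurable_continuous_onI)
  define G where "G x = (LBINT v:{0..1}. v powr (\<alpha> - 1) * g (x - (x - a) * v))" for x
  have "continuous_on UNIV G"
    unfolding continuous_on_sequentially
  proof (intro allI ballI impI, elim conjE)
    fix u :: "nat \<Rightarrow> real" and x assume u: "u \<longlonglongrightarrow> x"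
    show "(G \<circ> u) \<longlonglongrightarrow> G x"
      unfolding G_def set_lebesgue_integral_def comp_def
    proof (rule integral_dominated_convergence)
      \<comment> \<open>The dominating function does not depend on the sequence: \<open>M\<close>
        bounds the extension, and the weight is integrable because
        \<open>\<alpha> > 0\<close>.\<close>
      show "integrable lborel (\<lambda>v. M * (indicator {0..1} v *\<^sub>R v powr (\<alpha> - 1)))"
        using set_integrable_powr_01[OF \<open>\<alpha> > 0\<close>] by (simp add: set_integrable_def)
      have "(\<lambda>i. g (u i - (u i - a) * v)) \<longlonglongrightarrow> g (x - (x - a) * v)" for v
        by (rule continuous_on_tendsto_compose[OF g(1)]) (auto intro!: tendsto_intros u)
      then show "AE v in lborel.
          (\<lambda>i. indicator {0..1} v *\<^sub>R (v powr (\<alpha> - 1) * g (u i - (u i - a) * v)))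
          \<longlonglongrightarrow> indicator {0..1} v *\<^sub>R (v powr (\<alpha> - 1) * g (x - (x - a) * v))"
        by (intro AE_I2 tendsto_intros)
      show "AE v in lborel. norm (indicator {0..1} v *\<^sub>R (v powr (\<alpha> - 1) * g (u i - (u i - a) * v)))
          \<le> M * (indicator {0..1} v *\<^sub>R v powr (\<alpha> - 1))" for i
        using g(2) by (intro AE_I2) (auto simp: abs_mult indicator_def mult.commute[of M] intro!: mult_left_mono)
    qed measurable
  qed
  \<comment> \<open>The exponent \<open>\<alpha> > 0\<close> keeps the prefactor continuous at
    \<open>x = a\<close>, where its base vanishes.\<close>
  then have "continuous_on {a..b} (\<lambda>x. (x - a) powr \<alpha> / Gamma \<alpha> * G x)"
    using \<open>\<alpha> > 0\<close> Gamma_real_pos[OF \<open>\<alpha> > 0\<close>]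
    by (intro continuous_intros continuous_on_powr')
      (auto simp del: Gamma_real_pos intro: continuous_on_subset)
  moreover have "(x - a) powr \<alpha> / Gamma \<alpha> * G x = rl_integral a \<alpha> f x" if "x \<in> {a..b}" for x
  proof -
    have "rl_integral a \<alpha> f x = rl_integral a \<alpha> g x"
      using that g(3) by (intro rl_integral_cong) auto
    also have "\<dots> = (x - a) powr \<alpha> / Gamma \<alpha> * G x"
      using that \<open>\<alpha> > 0\<close> unfolding G_def by (intro rl_integral_eq_scaled) auto
    finally show ?thesis ..
  qed
  ultimately show ?thesis by (rule continuous_on_eq)
qed

text \<open>Order 0 is the identity. For positive orders the bounded case applies to the clamped
  extension, since integrals up to \<open>x\<close> see only values on \<open>[a,x]\<close>.\<close>

lemma rl_integral_semigroup:
  assumes "0 \<le> \<alpha>" "0 \<le> \<beta>" "continuous_on {a..b} f" "x \<in> {a..b}"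
  shows "rl_integral a \<alpha> (rl_integral a \<beta> f) x = rl_integral a (\<alpha> + \<beta>) f x"
proof (cases "\<alpha> = 0 \<or> \<beta> = 0")
  case True
  then show ?thesis by (auto simp: rl_integral_def[abs_def])
next
  case False
  with assms have "\<alpha> > 0" "\<beta> > 0" "a \<le> b" "a \<le> x" by auto
  obtain g M where g: "continuous_on UNIV g" "\<And>t. \<bar>g t\<bar> \<le> M" "\<And>t. t \<in> {a..b} \<Longrightarrow> g t = f t"
    using clamped_extension[OF \<open>a \<le> b\<close> assms(3)] by blast
  have gf: "rl_integral a \<delta> g t = rl_integral a \<delta> f t" if "t \<in> {a..x}" for \<delta> t
    using that assms(4) g(3) by (intro rl_integral_cong) auto
  have "rl_integral a \<alpha> (rl_integral a \<beta> f) x = rl_integral a \<alpha> (rl_integral a \<beta> g) x"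
    by (rule rl_integral_cong) (use gf \<open>a \<le> x\<close> in auto)
  also have "\<dots> = rl_integral a (\<alpha> + \<beta>) g x"
    using \<open>\<alpha> > 0\<close> \<open>\<beta> > 0\<close> \<open>a \<le> x\<close> g
    by (intro rl_integral_semigroup_bounded borel_measurable_continuous_onI)
  also have "\<dots> = rl_integral a (\<alpha> + \<beta>) f x"
    using gf \<open>a \<le> x\<close> by simp
  finally show ?thesis .
qed

section \<open>Order one: the fundamental theorem of calculus\<close>

lemma rl_integral_1:
  assumes "continuous_on {a..x} f"
  shows "rl_integral a 1 f x = integral {a..x} f"
proof -
  have f: "set_integrable lborel {a..x} f"
    using assms by (rule borel_integrable_atLeastAtMost')
  \<comment> \<open>At \<open>t = x\<close> the kernel is \<open>0 powr 0 = 0\<close> instead of 1,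
    so the integrands agree only off a null set.\<close>
  have "AE t in lborel. t \<noteq> x" by (rule AE_lborel_singleton)
  then have "(LBINT t:{a..x}. (x - t) powr (1 - 1) * f t) = (LBINT t:{a..x}. f t)"
    unfolding set_lebesgue_integral_def
    using borel_measurable_integrable[OF f[unfolded set_integrable_def]]
    by (intro integral_cong_AE) (auto simp: indicator_def mult.left_commute)
  then show ?thesis
    using set_borel_integral_eq_integral(2)[OF f] by (simp add: rl_integral_def)
qed

lemma has_vector_derivative_rl_integral_1:
  assumes "continuous_on {a..b} f" "x \<in> {a..b}"
  shows "(rl_integral a 1 f has_vector_derivative f x) (at x within {a..b})"
proof (rule has_vector_derivative_transform)
  show "((\<lambda>u. integral {a..u} f) has_vector_derivative f x) (at x within {a..b})"
    using assms by (rule integral_has_vector_derivative)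
  show "rl_integral a 1 f u = integral {a..u} f" if "u \<in> {a..b}" for u
    using that assms by (intro rl_integral_1) (auto intro: continuous_on_subset)
qed (use assms in auto)

lemma rl_integral_1_derivative:
  assumes "\<And>x. x \<in> {a..b} \<Longrightarrow> (F has_vector_derivative g x) (at x within {a..b})"
    and "continuous_on {a..b} g" "F a = 0" "x \<in> {a..b}"
  shows "rl_integral a 1 g x = F x"
proof -
  have "(g has_integral (F x - F a)) {a..x}"
    using assms(4) has_vector_derivative_within_subset[OF assms(1)]
    by (intro fundamental_theorem_of_calculus) auto
  moreover have "continuous_on {a..x} g"
    using assms by (auto intro: continuous_on_subset)
  ultimately show ?thesis
    using assms(3) by (simp add: rl_integral_1 integral_unique)
qed

section \<open>Iterated derivatives within \<open>[a,b]\<close>\<close>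

lemma deriv_on_eqI:
  assumes "a < b" "x \<in> {a..b}" "(f has_vector_derivative d) (at x within {a..b})"
  shows "deriv_on a b f x = d"
  unfolding deriv_on_def using assms by (rule vector_derivative_within_closed_interval)

lemma has_vector_derivative_deriv_on:
  assumes "f differentiable_on {a..b}" "x \<in> {a..b}"
  shows "(f has_vector_derivative deriv_on a b f x) (at x within {a..b})"
  using assms by (simp add: deriv_on_def differentiable_on_def flip: vector_derivative_works)

text \<open>Both functions have the same candidate derivatives at \<open>x\<close>, so the choice in
  \<open>vector_derivative\<close> agrees even where no derivative exists.\<close>

lemma deriv_on_cong:
  assumes "\<And>t. t \<in> {a..b} \<Longrightarrow> f t = g t" "x \<in> {a..b}"
  shows "deriv_on a b f x = deriv_on a b g x"
proof -
  have "(f has_vector_derivative d) (at x within {a..b}) \<longleftrightarrow>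
      (g has_vector_derivative d) (at x within {a..b})" for d
    using assms by (metis has_vector_derivative_transform)
  then show ?thesis by (simp add: deriv_on_def vector_derivative_def)
qed

lemma funpow_deriv_on_cong:
  assumes "\<And>t. t \<in> {a..b} \<Longrightarrow> f t = g t" "x \<in> {a..b}"
  shows "(deriv_on a b ^^ k) f x = (deriv_on a b ^^ k) g x"
  using assms(2)
proof (induction k arbitrary: x)
  case (Suc k)
  then show ?case by (auto intro: deriv_on_cong)
qed (use assms in simp)

lemma times_differentiable_on_transform:
  assumes "times_differentiable_on m a b f" "\<And>t. t \<in> {a..b} \<Longrightarrow> f t = g t"
  shows "times_differentiable_on m a b g"
  unfolding times_differentiable_on_def differentiable_on_def
proof (intro allI impI ballI)
  fix k x assume "k < m" and x: "x \<in> {a..b}"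
  then have "((deriv_on a b ^^ k) f) differentiable (at x within {a..b})"
    using assms(1) unfolding times_differentiable_on_def differentiable_on_def by blast
  then show "((deriv_on a b ^^ k) g) differentiable (at x within {a..b})"
    using x funpow_deriv_on_cong[OF assms(2)]
    by (rule differentiable_transform_within[OF _ zero_less_one])
qed

text \<open>Splits off the derivative taken first, the one that cancels an outermost integral of
  order one.\<close>

lemma times_differentiable_on_Suc:
  "times_differentiable_on (Suc m) a b f \<longleftrightarrow>
     f differentiable_on {a..b} \<and> times_differentiable_on m a b (deriv_on a b f)"
  by (auto simp: times_differentiable_on_def All_less_Suc2 funpow_Suc_right simp del: funpow.simps)

lemma ceiling_unit_interval: "0 < \<beta> \<Longrightarrow> \<beta> \<le> 1 \<Longrightarrow> \<lceil>\<beta>::real\<rceil> = 1"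
  by (simp add: ceiling_eq_iff)

lemma cont_rl_differentiable_unit_iff:
  assumes "0 < \<beta>" "\<beta> \<le> 1"
  shows "cont_rl_differentiable a b \<beta> f \<longleftrightarrow> continuous_on {a..b} f \<and>
     rl_integral a (1 - \<beta>) f differentiable_on {a..b} \<and>
     continuous_on {a..b} (deriv_on a b (rl_integral a (1 - \<beta>) f))"
    and "rl_deriv a b \<beta> f = deriv_on a b (rl_integral a (1 - \<beta>) f)"
  using ceiling_unit_interval[OF assms]
  by (auto simp: cont_rl_differentiable_def rl_deriv_def times_differentiable_on_def)

section \<open>Fractional integrals and derivatives as inverses of each other\<close>

text \<open>A derivative of order \<open>\<beta>\<close> removes \<open>\<beta>\<close> from the
  order of integration: the exponents \<open>(1 - \<beta>) + \<alpha>\<close> regroup as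
  \<open>1 + (\<alpha> - \<beta>)\<close>, and the ordinary derivative cancels the outer integral of
  order one.\<close>

lemma rl_deriv_of_rl_integral:
  assumes "a < b" "continuous_on {a..b} g" "0 \<le> \<beta>" "\<beta> \<le> \<alpha>" "\<beta> \<le> 1"
    and f: "\<And>x. x \<in> {a..b} \<Longrightarrow> f x = rl_integral a \<alpha> g x"
  shows "cont_rl_differentiable a b \<beta> f"
    and "\<And>x. x \<in> {a..b} \<Longrightarrow> rl_deriv a b \<beta> f x = rl_integral a (\<alpha> - \<beta>) g x"
proof -
  have cont: "continuous_on {a..b} (rl_integral a \<delta> g)" if "0 \<le> \<delta>" for \<delta>
    using that assms(2) by (rule continuous_on_rl_integral)
  have cont_f: "continuous_on {a..b} f"
    using cont[of \<alpha>] assms(3,4) f by (auto intro: continuous_on_eq)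
  have "cont_rl_differentiable a b \<beta> f \<and>
      (\<forall>x\<in>{a..b}. rl_deriv a b \<beta> f x = rl_integral a (\<alpha> - \<beta>) g x)"
  \<comment> \<open>For \<open>\<beta> = 0\<close> the ceiling is 0 and no derivative is taken; the
    formula with one derivative covers \<open>0 < \<beta> \<le> 1\<close>.\<close>
  proof (cases "\<beta> = 0")
    case True
    then show ?thesis using cont_f f by simp
  next
    case False
    with assms have "\<beta> > 0" by simp
    let ?F = "rl_integral a (1 - \<beta>) f" and ?g = "rl_integral a (\<alpha> - \<beta>) g"
    have F: "?F x = rl_integral a 1 ?g x" if "x \<in> {a..b}" for x
    proof -
      have "?F x = rl_integral a (1 - \<beta>) (rl_integral a \<alpha> g) x"
        using that f by (intro rl_integral_cong) auto
      also have "\<dots> = rl_integral a (1 + (\<alpha> - \<beta>)) g x"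
        using assms that by (subst rl_integral_semigroup) (auto simp: algebra_simps)
      also have "\<dots> = rl_integral a 1 ?g x"
        using assms that by (subst rl_integral_semigroup) auto
      finally show ?thesis .
    qed
    have deriv: "(?F has_vector_derivative ?g x) (at x within {a..b})" if "x \<in> {a..b}" for x
      using that F has_vector_derivative_rl_integral_1[of a b ?g x] cont assms
      by (metis diff_ge_0_iff_ge has_vector_derivative_transform)
    then have "?F differentiable_on {a..b}"
      unfolding differentiable_on_def by (blast intro: differentiableI_vector)
    moreover have "deriv_on a b ?F x = ?g x" if "x \<in> {a..b}" for x
      using assms(1) that deriv by (blast intro: deriv_on_eqI)
    moreover from this have "continuous_on {a..b} (deriv_on a b ?F)"
      using cont[of "\<alpha> - \<beta>"] assms(4) by (auto intro: continuous_on_eq)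
    ultimately show ?thesis
      using cont_f assms(5) by (simp add: cont_rl_differentiable_unit_iff[OF \<open>\<beta> > 0\<close>])
  qed
  then show "cont_rl_differentiable a b \<beta> f"
    and "\<And>x. x \<in> {a..b} \<Longrightarrow> rl_deriv a b \<beta> f x = rl_integral a (\<alpha> - \<beta>) g x"
    by auto
qed

text \<open>Inversion of Abel's integral equation. The usual boundary term, a multiple of
  \<open>(x - a) powr (\<alpha> - 1)\<close>, has as coefficient the value of \<open>?F\<close> at
  \<open>a\<close>, which is zero.\<close>

lemma rl_integral_of_rl_deriv:
  assumes "a < b" "0 < \<alpha>" "\<alpha> < 1" "cont_rl_differentiable a b \<alpha> f" "x \<in> {a..b}"
  shows "rl_integral a \<alpha> (rl_deriv a b \<alpha> f) x = f x"
proof -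
  let ?g = "rl_deriv a b \<alpha> f" and ?F = "rl_integral a (1 - \<alpha>) f"
  have f: "continuous_on {a..b} f" and g: "continuous_on {a..b} ?g"
    and F: "?F differentiable_on {a..b}" "?g = deriv_on a b ?F"
    using assms by (auto simp: cont_rl_differentiable_unit_iff)
  have J\<alpha>: "continuous_on {a..b} (rl_integral a \<alpha> ?g)"
    using assms g by (intro continuous_on_rl_integral) auto
  have Fg: "?F y = rl_integral a 1 ?g y" if "y \<in> {a..b}" for y
    using rl_integral_1_derivative[of a b ?F ?g y] has_vector_derivative_deriv_on[OF F(1)] g that
      assms by (simp add: F(2) rl_integral_left_endpoint)
  have eq: "rl_integral a 1 f y = rl_integral a 1 (rl_integral a \<alpha> ?g) y" if "y \<in> {a..b}" for y
  proof -
    have "rl_integral a 1 f y = rl_integral a \<alpha> ?F y"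
      using assms f that by (subst rl_integral_semigroup) auto
    also have "\<dots> = rl_integral a \<alpha> (rl_integral a 1 ?g) y"
      using that Fg by (intro rl_integral_cong) auto
    also have "\<dots> = rl_integral a 1 (rl_integral a \<alpha> ?g) y"
      using assms g that by (simp add: rl_integral_semigroup[of _ _ a b] add.commute)
    finally show ?thesis .
  qed
  \<comment> \<open>Both integrands are continuous, so differentiating the two equal integrals
    recovers them at every point, endpoints included.\<close>
  have "f x = deriv_on a b (rl_integral a 1 f) x"
    using assms f by (intro deriv_on_eqI[symmetric] has_vector_derivative_rl_integral_1)
  also have "\<dots> = deriv_on a b (rl_integral a 1 (rl_integral a \<alpha> ?g)) x"
    using eq assms by (intro deriv_on_cong)
  also have "\<dots> = rl_integral a \<alpha> ?g x"
    using assms J\<alpha> by (intro deriv_on_eqI has_vector_derivative_rl_integral_1)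
  finally show ?thesis ..
qed

section \<open>Composition of fractional derivatives\<close>

lemma rl_deriv_rl_deriv_unit:
  assumes "a < b" "0 \<le> \<beta>" "\<beta> < \<alpha>" "\<alpha> < 1" "cont_rl_differentiable a b \<alpha> f"
  shows "cont_rl_differentiable a b \<beta> f" "rl_deriv a b \<beta> f a = 0"
    "cont_rl_differentiable a b (\<alpha> - \<beta>) (rl_deriv a b \<beta> f)"
    "\<And>x. x \<in> {a..b} \<Longrightarrow> rl_deriv a b (\<alpha> - \<beta>) (rl_deriv a b \<beta> f) x = rl_deriv a b \<alpha> f x"
proof -
  let ?g = "rl_deriv a b \<alpha> f"
  have g: "continuous_on {a..b} ?g"
    using assms by (simp add: cont_rl_differentiable_def)
  have f: "f x = rl_integral a \<alpha> ?g x" if "x \<in> {a..b}" for x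
    using rl_integral_of_rl_deriv[of a b \<alpha> f x] assms that by simp
  note 1 = rl_deriv_of_rl_integral[OF assms(1) g assms(2) _ _ f]
  show "cont_rl_differentiable a b \<beta> f"
    using assms by (intro 1) auto
  have f1: "rl_deriv a b \<beta> f x = rl_integral a (\<alpha> - \<beta>) ?g x" if "x \<in> {a..b}" for x
    using assms that by (intro 1) auto
  show "rl_deriv a b \<beta> f a = 0"
    using f1[of a] assms by (simp add: rl_integral_left_endpoint)
  note 2 = rl_deriv_of_rl_integral[OF assms(1) g _ order_refl _ f1]
  show "cont_rl_differentiable a b (\<alpha> - \<beta>) (rl_deriv a b \<beta> f)"
    using assms by (intro 2) auto
  show "rl_deriv a b (\<alpha> - \<beta>) (rl_deriv a b \<beta> f) x = ?g x" if "x \<in> {a..b}" for x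
    \<comment> \<open>The remaining order of integration is
      \<open>(\<alpha> - \<beta>) - (\<alpha> - \<beta>) = 0\<close>, which is the identity.\<close>
    using assms that 2(2)[of x] by (simp add: rl_integral_def)
qed

text \<open>Since \<open>f a = 0\<close>, \<open>f\<close> is the integral of order one of its
  derivative, and the same reduction runs with 1 in place of \<open>\<alpha>\<close>.\<close>

lemma rl_deriv_rl_deriv_C1:
  assumes "a < b" "C1_on a b f" "f a = 0" "0 \<le> \<beta>" "\<beta> \<le> 1"
  shows "cont_rl_differentiable a b \<beta> f"
    "cont_rl_differentiable a b (1 - \<beta>) (rl_deriv a b \<beta> f)"
    "\<And>x. x \<in> {a..b} \<Longrightarrow> rl_deriv a b (1 - \<beta>) (rl_deriv a b \<beta> f) x = deriv_on a b f x"
proof -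
  let ?g = "deriv_on a b f"
  have g: "continuous_on {a..b} ?g"
    using assms by (simp add: C1_on_def)
  have f: "f x = rl_integral a 1 ?g x" if "x \<in> {a..b}" for x
    using assms that g
    by (intro rl_integral_1_derivative[symmetric, of a b] has_vector_derivative_deriv_on)
      (simp_all add: C1_on_def)
  note 1 = rl_deriv_of_rl_integral[OF assms(1) g assms(4) assms(5,5) f]
  show "cont_rl_differentiable a b \<beta> f" by (rule 1)
  note 2 = rl_deriv_of_rl_integral[OF assms(1) g _ order_refl _ 1(2)]
  show "cont_rl_differentiable a b (1 - \<beta>) (rl_deriv a b \<beta> f)"
    using assms by (intro 2) auto
  show "rl_deriv a b (1 - \<beta>) (rl_deriv a b \<beta> f) x = ?g x" if "x \<in> {a..b}" for x
    using assms that 2(2)[of x] by (simp add: rl_integral_def)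
qed

text \<open>Writing \<open>h\<close> as the integral of order \<open>\<beta>\<close> of
  \<open>?h1\<close> expresses both sides as ordinary derivatives of integrals of
  \<open>?h1\<close>; it remains to match the numbers of derivatives.\<close>

lemma rl_deriv_rl_deriv_converse:
  assumes "a < b" "0 < \<beta>" "\<beta> < 1" "0 < \<gamma>" "cont_rl_differentiable a b \<beta> h"
    and "cont_rl_differentiable a b \<gamma> (rl_deriv a b \<beta> h)"
  shows "cont_rl_differentiable a b (\<beta> + \<gamma>) h"
    "\<And>x. x \<in> {a..b} \<Longrightarrow> rl_deriv a b \<gamma> (rl_deriv a b \<beta> h) x = rl_deriv a b (\<beta> + \<gamma>) h x"
proof -
  let ?h1 = "rl_deriv a b \<beta> h"
  define m where "m = nat \<lceil>\<gamma>\<rceil>"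
  define n where "n = nat \<lceil>\<beta> + \<gamma>\<rceil>"
  define H where "H = rl_integral a (of_int \<lceil>\<gamma>\<rceil> - \<gamma>) ?h1"
  define F where "F = rl_integral a (of_int \<lceil>\<beta> + \<gamma>\<rceil> - (\<beta> + \<gamma>)) h"
  have h: "continuous_on {a..b} h" and h1: "continuous_on {a..b} ?h1"
    and H: "times_differentiable_on m a b H" "continuous_on {a..b} ((deriv_on a b ^^ m) H)"
    using assms by (simp_all add: cont_rl_differentiable_def rl_deriv_def[of a b \<gamma>] m_def H_def)
  have F: "F x = rl_integral a (of_int \<lceil>\<beta> + \<gamma>\<rceil> - \<gamma>) ?h1 x" if "x \<in> {a..b}" for x
  proof -
    have "F x = rl_integral a (of_int \<lceil>\<beta> + \<gamma>\<rceil> - (\<beta> + \<gamma>)) (rl_integral a \<beta> ?h1) x"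
      unfolding F_def using that rl_integral_of_rl_deriv[of a b \<beta> h] assms
      by (intro rl_integral_cong) auto
    also have "\<dots> = rl_integral a (of_int \<lceil>\<beta> + \<gamma>\<rceil> - \<gamma>) ?h1 x"
      using assms(2) h1 that by (subst rl_integral_semigroup) auto
    finally show ?thesis .
  qed
  \<comment> \<open>As \<open>0 < \<beta> < 1\<close>, adding \<open>\<beta>\<close> raises the
    ceiling by at most one. If it stays, \<open>F\<close> and \<open>H\<close> agree on
    \<open>[a,b]\<close>.\<close>
  have "\<lceil>\<beta> + \<gamma>\<rceil> = \<lceil>\<gamma>\<rceil> \<or> \<lceil>\<beta> + \<gamma>\<rceil> = \<lceil>\<gamma>\<rceil> + 1"
    using assms(2,3) by linarith
  then have key: "times_differentiable_on n a b F \<and>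
      (\<forall>x\<in>{a..b}. (deriv_on a b ^^ n) F x = (deriv_on a b ^^ m) H x)"
  proof
    assume c: "\<lceil>\<beta> + \<gamma>\<rceil> = \<lceil>\<gamma>\<rceil>"
    then have "F x = H x" if "x \<in> {a..b}" for x
      using F that by (simp add: H_def)
    moreover from c have "n = m" by (simp add: n_def m_def)
    ultimately show ?thesis
      using H(1) times_differentiable_on_transform[of m a b H F] funpow_deriv_on_cong[of a b F H]
      by auto
  next
    assume c: "\<lceil>\<beta> + \<gamma>\<rceil> = \<lceil>\<gamma>\<rceil> + 1"
    \<comment> \<open>The additional derivative meets an additional order of integration: the first
      derivative of \<open>F\<close> is \<open>H\<close>, leaving \<open>m\<close> derivatives of
      \<open>H\<close>.\<close>
    have FH: "F x = rl_integral a 1 H x" if "x \<in> {a..b}" for x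
      unfolding F[OF that] H_def c using h1 that
      by (subst rl_integral_semigroup) (auto simp: algebra_simps)
    have cont_H: "continuous_on {a..b} H"
      unfolding H_def using h1 by (intro continuous_on_rl_integral) auto
    have F': "(F has_vector_derivative H x) (at x within {a..b})" if "x \<in> {a..b}" for x
      using that FH has_vector_derivative_rl_integral_1[OF cont_H that]
      by (metis has_vector_derivative_transform)
    then have "F differentiable_on {a..b}"
      unfolding differentiable_on_def by (blast intro: differentiableI_vector)
    moreover have dF: "deriv_on a b F x = H x" if "x \<in> {a..b}" for x
      using assms(1) that F' by (blast intro: deriv_on_eqI)
    moreover have "n = Suc m"
      unfolding n_def m_def c using assms(4) by (simp add: nat_add_distrib)
    ultimately show ?thesis
      using H(1) times_differentiable_on_transform[of m a b H "deriv_on a b F"]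
        funpow_deriv_on_cong[of a b "deriv_on a b F" H]
      by (auto simp: times_differentiable_on_Suc funpow_Suc_right simp del: funpow.simps)
  qed
  then show "cont_rl_differentiable a b (\<beta> + \<gamma>) h"
    using h continuous_on_eq[OF H(2), of "(deriv_on a b ^^ n) F"]
    by (simp add: cont_rl_differentiable_def rl_deriv_def n_def F_def)
  show "rl_deriv a b \<gamma> ?h1 x = rl_deriv a b (\<beta> + \<gamma>) h x" if "x \<in> {a..b}" for x
    using key that by (simp add: rl_deriv_def[of a b \<gamma>] rl_deriv_def[of a b "\<beta> + \<gamma>"] n_def F_def m_def H_def)
qed

theorem theorem3:
  fixes a b :: real
  assumes "a < b"
  shows
    "(\<forall>\<alpha> \<beta> f. 0 \<le> \<beta> \<and> \<beta> < \<alpha> \<and> \<alpha> < 1 \<and> cont_rl_differentiable a b \<alpha> f \<longrightarrow>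
        (cont_rl_differentiable a b \<beta> f \<and>
         continuous_on {a..b} (rl_deriv a b \<beta> f) \<and>
         rl_deriv a b \<beta> f a = 0) \<and>
        (cont_rl_differentiable a b (\<alpha> - \<beta>) (rl_deriv a b \<beta> f) \<and>
         (\<forall>x\<in>{a..b}. rl_deriv a b (\<alpha> - \<beta>) (rl_deriv a b \<beta> f) x = rl_deriv a b \<alpha> f x)))
     \<and>
     (\<forall>f. C1_on a b f \<and> f a = 0 \<longrightarrow>
        (\<forall>\<beta>. 0 \<le> \<beta> \<and> \<beta> \<le> 1 \<longrightarrow>
          cont_rl_differentiable a b \<beta> f \<and>
          continuous_on {a..b} (rl_deriv a b \<beta> f) \<and>
          cont_rl_differentiable a b (1 - \<beta>) (rl_deriv a b \<beta> f) \<and>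
          (\<forall>x\<in>{a..b}. rl_deriv a b (1 - \<beta>) (rl_deriv a b \<beta> f) x = deriv_on a b f x)))
     \<and>
     (\<forall>\<beta> \<gamma> h. 0 < \<beta> \<and> \<beta> < 1 \<and> 0 < \<gamma> \<and>
        cont_rl_differentiable a b \<beta> h \<and>
        cont_rl_differentiable a b \<gamma> (rl_deriv a b \<beta> h) \<longrightarrow>
          cont_rl_differentiable a b (\<beta> + \<gamma>) h \<and>
          (\<forall>x\<in>{a..b}. rl_deriv a b \<gamma> (rl_deriv a b \<beta> h) x = rl_deriv a b (\<beta> + \<gamma>) h x))"
proof (intro conjI allI impI ballI; (elim conjE)?)
  fix \<alpha> \<beta> f
  assume *: "0 \<le> \<beta>" "\<beta> < \<alpha>" "\<alpha> < 1" "cont_rl_differentiable a b \<alpha> f"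
  note 1 = rl_deriv_rl_deriv_unit[OF assms *]
  show "cont_rl_differentiable a b \<beta> f" "rl_deriv a b \<beta> f a = 0"
    "cont_rl_differentiable a b (\<alpha> - \<beta>) (rl_deriv a b \<beta> f)" by (rule 1)+
  then show "continuous_on {a..b} (rl_deriv a b \<beta> f)" by (simp add: cont_rl_differentiable_def)
  show "rl_deriv a b (\<alpha> - \<beta>) (rl_deriv a b \<beta> f) x = rl_deriv a b \<alpha> f x" if "x \<in> {a..b}" for x
    using that by (rule 1)
next
  fix f and \<beta> :: real
  assume *: "C1_on a b f" "f a = 0" "0 \<le> \<beta>" "\<beta> \<le> 1"
  note 1 = rl_deriv_rl_deriv_C1[OF assms *]
  show "cont_rl_differentiable a b \<beta> f"
    "cont_rl_differentiable a b (1 - \<beta>) (rl_deriv a b \<beta> f)" by (rule 1)+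
  then show "continuous_on {a..b} (rl_deriv a b \<beta> f)" by (simp add: cont_rl_differentiable_def)
  show "rl_deriv a b (1 - \<beta>) (rl_deriv a b \<beta> f) x = deriv_on a b f x" if "x \<in> {a..b}" for x
    using that by (rule 1)
next
  fix \<beta> \<gamma> h
  assume *: "0 < \<beta>" "\<beta> < 1" "0 < \<gamma>" "cont_rl_differentiable a b \<beta> h"
    "cont_rl_differentiable a b \<gamma> (rl_deriv a b \<beta> h)"
  note 1 = rl_deriv_rl_deriv_converse[OF assms *]
  show "cont_rl_differentiable a b (\<beta> + \<gamma>) h" by (rule 1)
  show "rl_deriv a b \<gamma> (rl_deriv a b \<beta> h) x = rl_deriv a b (\<beta> + \<gamma>) h x" if "x \<in> {a..b}" for x
    using that by (rule 1)
qed

end
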